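(* Let $G$ be a finitely generated group with word length $|\cdot|$ associated with a fixed finite symmetric generating set, let $\pi\colon G\to\mathcal U(\mathcal H)$ be a strongly mixing unitary representation on a Hilbert space $\mathcal H$, and let $b\colon G\to\mathcal H$ be a $1$-cocycle for $\pi$. Then $$\limsup_{|g|\to\infty}\frac{\lVert b(g)\rVert}{|g|}=0.$$
   Context: $G$ is a discrete group with a fixed finite symmetric generating set, and $|g|$ is the associated word length. The statement $\limsup_{|g|\to\infty}\lVert b(g)\rVert/|g|=0$ means: for every $\varepsilon>0$ there is $N$ such that $\lVert b(g)\rVert\le\varepsilon|g|$ for all $g\in G$ with $|g|\ge N$. $\mathcal U(\mathcal H)$ is the unitary group of $\mathcal H$. A unitary representation $\pi$ is strongly mixing if $\langle\pi(g)\xi,\eta\rangle\to 0$ as $g\to\infty$ (i.e. as $g$ leaves every finite subset of $G$) for all $\xi,\eta\in\mathcal H$. A $1$-cocycle for $\pi$ is a map $b\colon G\to\mathcal H$ with $b(gh)=b(g)+\pi(g)b(h)$ for all $g,h\in G$. *)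

theory Defs
  imports "HOL-Analysis.Inner_Product" "HOL-Algebra.Generated_Groups"
begin

(* Complex inner product spaces. The real inner product inherited from real_inner is the real
   part of cinner, so that norm x = sqrt (Re (cinner x x)); positive definiteness of cinner and
   the unit law for scaleC follow from the corresponding properties of the real structure. *)
class complex_inner = real_inner +
  fixes scaleC :: "complex \<Rightarrow> 'a \<Rightarrow> 'a" (infixr "*\<^sub>C" 75)
    and cinner :: "'a \<Rightarrow> 'a \<Rightarrow> complex"
  assumes scaleC_add_right: "c *\<^sub>C (x + y) = c *\<^sub>C x + c *\<^sub>C y"
    and scaleC_add_left: "(c + d) *\<^sub>C x = c *\<^sub>C x + d *\<^sub>C x"
    and scaleC_scaleC: "c *\<^sub>C (d *\<^sub>C x) = (c * d) *\<^sub>C x"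
    and scaleR_scaleC: "r *\<^sub>R x = complex_of_real r *\<^sub>C x"
    and cinner_add_left: "cinner (x + y) z = cinner x z + cinner y z"
    and cinner_scaleC_left: "cinner (c *\<^sub>C x) y = c * cinner x y"
    and cinner_commute: "cinner x y = cnj (cinner y x)"
    and inner_eq_Re_cinner: "inner x y = Re (cinner x y)"

class complex_hilbert_space = complex_inner + complete_space

definition unitary :: "('h::complex_hilbert_space \<Rightarrow> 'h) \<Rightarrow> bool" where
  "unitary U \<longleftrightarrow>
     (\<forall>x y. U (x + y) = U x + U y) \<and> (\<forall>c x. U (c *\<^sub>C x) = c *\<^sub>C U x) \<and>
     (\<forall>x y. cinner (U x) (U y) = cinner x y) \<and> surj U"

definition unitary_group :: "('h::complex_hilbert_space \<Rightarrow> 'h) monoid" where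
  "unitary_group = \<lparr>carrier = {U. unitary U}, mult = (\<circ>), one = id\<rparr>"

definition unitary_rep ::
  "('g, 'm) monoid_scheme \<Rightarrow> ('g \<Rightarrow> 'h::complex_hilbert_space \<Rightarrow> 'h) \<Rightarrow> bool" where
  "unitary_rep G \<pi> \<longleftrightarrow> \<pi> \<in> hom G unitary_group"

(* The filter is the one of complements in carrier G of finite sets. *)
definition strongly_mixing ::
  "('g, 'm) monoid_scheme \<Rightarrow> ('g \<Rightarrow> 'h::complex_hilbert_space \<Rightarrow> 'h) \<Rightarrow> bool" where
  "strongly_mixing G \<pi> \<longleftrightarrow>
     (\<forall>\<xi> \<eta>. ((\<lambda>g. cinner (\<pi> g \<xi>) \<eta>) \<longlongrightarrow> 0) (inf cofinite (principal (carrier G))))"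

definition cocycle ::
  "('g, 'm) monoid_scheme \<Rightarrow> ('g \<Rightarrow> 'h::complex_hilbert_space \<Rightarrow> 'h) \<Rightarrow> ('g \<Rightarrow> 'h) \<Rightarrow> bool" where
  "cocycle G \<pi> b \<longleftrightarrow>
     (\<forall>g\<in>carrier G. \<forall>h\<in>carrier G. b (g \<otimes>\<^bsub>G\<^esub> h) = b g + \<pi> g (b h))"

definition symmetric_generating_set :: "('g, 'm) monoid_scheme \<Rightarrow> 'g set \<Rightarrow> bool" where
  "symmetric_generating_set G S \<longleftrightarrow>
     S \<subseteq> carrier G \<and> (\<forall>s\<in>S. inv\<^bsub>G\<^esub> s \<in> S) \<and> generate G S = carrier G"

definition word_length :: "('g, 'm) monoid_scheme \<Rightarrow> 'g set \<Rightarrow> 'g \<Rightarrow> nat" where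
  "word_length G S g =
     (LEAST n. \<exists>ws. length ws = n \<and> set ws \<subseteq> S \<and> foldr (\<otimes>\<^bsub>G\<^esub>) ws \<one>\<^bsub>G\<^esub> = g)"

end

theory Submission
  imports Defs
begin

text \<open>Write \<open>g = s\<^sub>1 \<cdots> s\<^sub>n\<close> as a geodesic word with prefixes \<open>g\<^sub>i\<close>. Then \<open>b g\<close> is the sum of the
  vectors \<open>\<pi>(g\<^sub>i) b(s\<^sub>i\<^sub>+\<^sub>1)\<close>, which are bounded, and the inner product of the \<open>i\<close>th and \<open>j\<close>th one is
  a coefficient of \<open>\<pi>\<close> at \<open>g\<^sub>i\<inverse> g\<^sub>j\<close>, an element of length \<open>j - i\<close>. By mixing, and since only
  finitely many coefficient functions occur, the vectors are uniformly almost orthogonal when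
  \<open>j - i\<close> is large, so expanding \<open>\<parallel>b g\<parallel>\<^sup>2\<close> gives \<open>o(n\<^sup>2)\<close>.\<close>

text \<open>The square of the norm is the sum of an \<open>n\<close> by \<open>n\<close> matrix of
  inner products. A row has fewer than \<open>2 * m\<close> entries within distance \<open>m\<close>
  of the diagonal, each at most \<open>M\<^sup>2\<close> by Cauchy-Schwarz; every other entry is at
  most \<open>\<delta>\<close>.\<close>

lemma norm_sum_almost_orthogonal:
  fixes v :: "nat \<Rightarrow> 'a::real_inner"
  assumes bound: "\<And>i. i < n \<Longrightarrow> norm (v i) \<le> M" and "0 \<le> M" "0 \<le> \<delta>" "0 < m"
    and orth: "\<And>i j. i < j \<Longrightarrow> j < n \<Longrightarrow> m \<le> j - i \<Longrightarrow> \<bar>inner (v i) (v j)\<bar> \<le> \<delta>"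
  shows "(norm (\<Sum>i<n. v i))\<^sup>2 \<le> \<delta> * (real n)\<^sup>2 + 2 * real m * M\<^sup>2 * real n"
proof -
  have orth': "inner (v i) (v j) \<le> \<delta>" if "i < n" "j < n" "m \<le> j - i \<or> m \<le> i - j" "i \<noteq> j" for i j
    using orth[of i j] orth[of j i] that by (auto simp: inner_commute abs_le_iff nat_neq_iff)
  have row: "(\<Sum>j<n. inner (v i) (v j)) \<le> \<delta> * real n + 2 * real m * M\<^sup>2" if i: "i < n" for i
  proof -
    \<comment> \<open>These are the \<open>j\<close> with distance less than \<open>m\<close> from
      \<open>i\<close>. Truncated subtraction cuts the interval off at 0, which only shrinks
      it.\<close>
    let ?near = "{i + 1 - m..<i + m}"
    \<comment> \<open>Allowing \<open>\<delta>\<close> on near entries too makes the bound a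
      constant plus an indicator, which can be summed separately.\<close>
    have "inner (v i) (v j) \<le> \<delta> + (if j \<in> ?near then M\<^sup>2 else 0)" if j: "j < n" for j
    proof (cases "j \<in> ?near")
      case True
      have "inner (v i) (v j) \<le> norm (v i) * norm (v j)"
        by (rule norm_cauchy_schwarz)
      also have "\<dots> \<le> M * M"
        using bound i j \<open>0 \<le> M\<close> by (intro mult_mono) auto
      finally show ?thesis
        using True \<open>0 \<le> \<delta>\<close> by (simp add: power2_eq_square)
    next
      case False
      \<comment> \<open>Since \<open>0 < m\<close>, the index \<open>i\<close> itself lies in
        \<open>?near\<close>, so a far entry is never on the diagonal.\<close>
      then have "m \<le> j - i \<or> m \<le> i - j" "i \<noteq> j"
        using \<open>0 < m\<close> by auto
      then show ?thesis
        using orth'[OF i j] unfolding if_not_P[OF False] by simp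
    qed
    then have "(\<Sum>j<n. inner (v i) (v j)) \<le> (\<Sum>j<n. \<delta> + (if j \<in> ?near then M\<^sup>2 else 0))"
      by (intro sum_mono) auto
    also have "\<dots> = \<delta> * real n + real (card ({..<n} \<inter> ?near)) * M\<^sup>2"
      by (simp add: sum.distrib del: atLeastLessThan_iff flip: sum.inter_restrict)
    also have "\<dots> \<le> \<delta> * real n + real (2 * m) * M\<^sup>2"
    proof -
      have "card ({..<n} \<inter> ?near) \<le> card ?near"
        by (intro card_mono) auto
      also have "\<dots> \<le> 2 * m"
        by simp
      finally show ?thesis
        by (intro add_left_mono mult_right_mono) auto
    qed
    finally show ?thesis
      by simp
  qed
  have "(norm (\<Sum>i<n. v i))\<^sup>2 = (\<Sum>i<n. \<Sum>j<n. inner (v i) (v j))"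
    unfolding power2_norm_eq_inner inner_sum_left by (simp only: inner_sum_right)
  also have "\<dots> \<le> (\<Sum>i<n. \<delta> * real n + 2 * real m * M\<^sup>2)"
    by (intro sum_mono row) auto
  also have "\<dots> = \<delta> * (real n)\<^sup>2 + 2 * real m * M\<^sup>2 * real n"
    by (simp add: power2_eq_square algebra_simps)
  finally show ?thesis .
qed

abbreviation word_prod :: "('g, 'm) monoid_scheme \<Rightarrow> 'g list \<Rightarrow> 'g" where
  "word_prod G ws \<equiv> foldr (\<otimes>\<^bsub>G\<^esub>) ws \<one>\<^bsub>G\<^esub>"

context group
begin

lemma word_prod_closed: "set ws \<subseteq> carrier G \<Longrightarrow> word_prod G ws \<in> carrier G"
  by (induction ws) auto

lemma word_prod_append:
  "set us \<subseteq> carrier G \<Longrightarrow> set vs \<subseteq> carrier G \<Longrightarrow>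
    word_prod G (us @ vs) = word_prod G us \<otimes> word_prod G vs"
  by (induction us) (auto simp: word_prod_closed m_assoc)

text \<open>Inverses of generators are again letters by symmetry of \<open>S\<close>, so positive
  words suffice. This guarantees that the \<open>LEAST\<close> in \<open>word_length\<close> ranges
  over a nonempty set.\<close>

lemma ex_word:
  assumes "symmetric_generating_set G S" and "g \<in> carrier G"
  obtains ws where "set ws \<subseteq> S" "word_prod G ws = g"
proof -
  have S: "S \<subseteq> carrier G" "\<forall>s\<in>S. inv s \<in> S" and "g \<in> generate G S"
    using assms by (auto simp: symmetric_generating_set_def)
  from this(3) have "\<exists>ws. set ws \<subseteq> S \<and> word_prod G ws = g"
  proof induction
    case one
    show ?case by (rule exI[of _ "[]"]) simp
  next
    case (incl h)
    then show ?case using S by (intro exI[of _ "[h]"]) auto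
  next
    case (inv h)
    then show ?case using S by (intro exI[of _ "[inv h]"]) auto
  next
    case (eng h1 h2)
    then obtain us vs where "set us \<subseteq> S" "word_prod G us = h1" "set vs \<subseteq> S" "word_prod G vs = h2"
      by blast
    then show ?case
      using S(1) by (intro exI[of _ "us @ vs"]) (auto simp: word_prod_append simp del: foldr_append)
  qed
  then show ?thesis using that by blast
qed

lemma word_length_le: "set ws \<subseteq> S \<Longrightarrow> word_length G S (word_prod G ws) \<le> length ws"
  unfolding word_length_def by (intro Least_le) blast

lemma geodesic_word:
  assumes "symmetric_generating_set G S" and "g \<in> carrier G"
  obtains ws where "set ws \<subseteq> S" "word_prod G ws = g" "length ws = word_length G S g"
proof -
  let ?P = "\<lambda>n. \<exists>ws. length ws = n \<and> set ws \<subseteq> S \<and> word_prod G ws = g"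
  obtain ws where "set ws \<subseteq> S" "word_prod G ws = g"
    using ex_word[OF assms] .
  then have "?P (length ws)" by blast
  then have "?P (word_length G S g)"
    unfolding word_length_def by (rule LeastI)
  then show ?thesis using that by blast
qed

text \<open>Factors of geodesics are geodesic: a shorter word for the middle factor could be
  substituted without changing the product, contradicting minimality of the whole word.\<close>

lemma word_length_factor:
  assumes gen: "symmetric_generating_set G S" and "set us \<subseteq> S" "set vs \<subseteq> S" "set ws \<subseteq> S"
    and geodesic: "word_length G S (word_prod G (us @ vs @ ws)) = length (us @ vs @ ws)"
  shows "length vs \<le> word_length G S (word_prod G vs)"
proof -
  have S: "S \<subseteq> carrier G"
    using gen by (simp add: symmetric_generating_set_def)
  have sub: "set us \<subseteq> carrier G" "set vs \<subseteq> carrier G" "set ws \<subseteq> carrier G"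
    using assms S by auto
  obtain vs' where vs': "set vs' \<subseteq> S" "word_prod G vs' = word_prod G vs"
      "length vs' = word_length G S (word_prod G vs)"
    using geodesic_word[OF gen] word_prod_closed sub by blast
  have "word_prod G (us @ vs' @ ws) = word_prod G (us @ vs @ ws)"
    using sub vs' S by (simp add: word_prod_append del: foldr_append)
  then have "length (us @ vs @ ws) \<le> length (us @ vs' @ ws)"
    using word_length_le[of "us @ vs' @ ws" S] geodesic assms vs' by simp
  then show ?thesis using vs' by simp
qed

lemma unitary_rep_inner:
  assumes "unitary_rep G \<pi>" "g \<in> carrier G"
  shows "inner (\<pi> g x) (\<pi> g y) = inner x y"
  using assms
  by (auto simp: unitary_rep_def hom_def unitary_group_def unitary_def inner_eq_Re_cinner Pi_def)

lemma unitary_rep_norm: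
  assumes "unitary_rep G \<pi>" "g \<in> carrier G"
  shows "norm (\<pi> g x) = norm x"
  using unitary_rep_inner[OF assms] by (simp add: norm_eq_sqrt_inner)

lemma unitary_rep_mult:
  assumes "unitary_rep G \<pi>" "g \<in> carrier G" "h \<in> carrier G"
  shows "\<pi> (g \<otimes> h) x = \<pi> g (\<pi> h x)"
  using assms by (auto simp: unitary_rep_def hom_def unitary_group_def)

lemma cocycle_one:
  assumes "unitary_rep G \<pi>" "cocycle G \<pi> b"
  shows "b \<one> = 0"
proof -
  have "b (\<one> \<otimes> \<one>) = b \<one> + \<pi> \<one> (b \<one>)"
    using assms(2) one_closed unfolding cocycle_def by blast
  then have "\<pi> \<one> (b \<one>) = 0" by simp
  then show ?thesis
    using unitary_rep_norm[OF assms(1), of \<one> "b \<one>"] by simp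
qed

text \<open>Appending a letter on the right leaves the earlier prefixes unchanged, so the cocycle
  identity contributes exactly one new summand.\<close>

lemma cocycle_word_prod:
  assumes "unitary_rep G \<pi>" "cocycle G \<pi> b" "set ws \<subseteq> carrier G"
  shows "b (word_prod G ws) = (\<Sum>i<length ws. \<pi> (word_prod G (take i ws)) (b (ws ! i)))"
  using assms(3)
proof (induction ws rule: rev_induct)
  case Nil
  then show ?case using cocycle_one[OF assms(1,2)] by simp
next
  case (snoc s ws)
  then have "word_prod G (ws @ [s]) = word_prod G ws \<otimes> s"
    by (simp add: word_prod_append del: foldr_append)
  then have "b (word_prod G (ws @ [s])) = b (word_prod G ws) + \<pi> (word_prod G ws) (b s)"
    using snoc.prems assms(2) word_prod_closed[of ws] by (simp add: cocycle_def)
  then show ?case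
    using snoc by (simp add: nth_append del: foldr_append)
qed

text \<open>For each pair of vectors mixing excludes only finitely many \<open>g\<close>. Finitely
  many pairs still exclude a finite set, and word length is bounded on it.\<close>

lemma strongly_mixing_uniform:
  assumes "strongly_mixing G \<pi>" "finite X" "finite Y" "0 < \<delta>"
  shows "\<exists>m>0. \<forall>g\<in>carrier G. m \<le> word_length G S g \<longrightarrow>
    (\<forall>x\<in>X. \<forall>y\<in>Y. \<bar>inner x (\<pi> g y)\<bar> \<le> \<delta>)"
proof -
  let ?F = "inf cofinite (principal (carrier G))"
  have "\<forall>\<^sub>F g in ?F. \<forall>x\<in>X. \<forall>y\<in>Y. \<bar>inner x (\<pi> g y)\<bar> \<le> \<delta>"
  proof (intro eventually_ball_finite ballI assms)
    fix x y
    have "((\<lambda>g. cinner (\<pi> g y) x) \<longlongrightarrow> 0) ?F"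
      using assms(1) by (simp add: strongly_mixing_def)
    then have "\<forall>\<^sub>F g in ?F. norm (cinner (\<pi> g y) x) < \<delta>"
      using \<open>0 < \<delta>\<close> by (simp add: tendsto_iff)
    then show "\<forall>\<^sub>F g in ?F. \<bar>inner x (\<pi> g y)\<bar> \<le> \<delta>"
    proof eventually_elim
      case (elim g)
      then show ?case
        using abs_Re_le_cmod[of "cinner (\<pi> g y) x"]
        by (simp add: inner_commute[of x] flip: inner_eq_Re_cinner)
    qed
  qed
  then have fin: "finite {g \<in> carrier G. \<not> (\<forall>x\<in>X. \<forall>y\<in>Y. \<bar>inner x (\<pi> g y)\<bar> \<le> \<delta>)}" (is "finite ?B")
    by (simp add: eventually_inf_principal eventually_cofinite not_imp)
  \<comment> \<open>If \<open>?B\<close> is empty, the \<open>Max\<close> is unspecified but the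
    claim is vacuous. The \<open>Suc\<close> makes the inequality strict and the threshold
    positive.\<close>
  have "\<forall>g\<in>?B. word_length G S g < Suc (Max (word_length G S ` ?B))"
    using fin by (simp add: le_imp_less_Suc)
  then show ?thesis
    by (intro exI[of _ "Suc (Max (word_length G S ` ?B))"]) (auto simp: not_le[symmetric])
qed

end

theorem corollary2:
  fixes G :: "('g, 'm) monoid_scheme"
    and S :: "'g set"
    and \<pi> :: "'g \<Rightarrow> 'h::complex_hilbert_space \<Rightarrow> 'h"
    and b :: "'g \<Rightarrow> 'h"
  assumes "group G"
    and "finite S" and "symmetric_generating_set G S"
    and "unitary_rep G \<pi>" and "strongly_mixing G \<pi>"
    and "cocycle G \<pi> b"
  shows "\<forall>\<epsilon>::real. \<epsilon> > 0 \<longrightarrow> ( \<exists>N::nat. \<forall>g\<in>carrier G.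
           word_length G S g \<ge> N \<longrightarrow> norm (b g) \<le> \<epsilon> * real (word_length G S g))"
proof (intro allI impI)
  fix \<epsilon> :: real
  assume "0 < \<epsilon>"
  interpret group G by fact
  have S: "S \<subseteq> carrier G"
    using assms(3) by (simp add: symmetric_generating_set_def)
  \<comment> \<open>Unlike a maximum, the sum is also meaningful for empty \<open>S\<close>.\<close>
  define M where "M = (\<Sum>s\<in>S. norm (b s))"
  have M: "norm (b s) \<le> M" if "s \<in> S" for s
    unfolding M_def using that \<open>finite S\<close> by (intro member_le_sum) auto
  have "0 \<le> M"
    unfolding M_def by (intro sum_nonneg) auto
  \<comment> \<open>Half of the target \<open>\<epsilon>\<^sup>2 * n\<^sup>2\<close> is reserved for
    the far pairs. The threshold \<open>m\<close> depends on \<open>S\<close>, \<open>b\<close>,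
    \<open>\<pi>\<close> and \<open>\<epsilon>\<close>, but not on the group element estimated
    later.\<close>
  obtain m where "0 < m" and m: "\<And>g s t. g \<in> carrier G \<Longrightarrow> m \<le> word_length G S g \<Longrightarrow>
      s \<in> S \<Longrightarrow> t \<in> S \<Longrightarrow> \<bar>inner (b s) (\<pi> g (b t))\<bar> \<le> \<epsilon>\<^sup>2 / 2"
    using strongly_mixing_uniform[OF assms(5), of "b ` S" "b ` S" "\<epsilon>\<^sup>2 / 2" S] \<open>finite S\<close> \<open>0 < \<epsilon>\<close>
    by auto
  \<comment> \<open>For \<open>n\<close> at least \<open>N\<close> the near-diagonal term
    \<open>2 * m * M\<^sup>2 * n\<close> fits into the other half,
    \<open>\<epsilon>\<^sup>2 * n\<^sup>2 / 2\<close>.\<close>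
  obtain N :: nat where N: "4 * real m * M\<^sup>2 / \<epsilon>\<^sup>2 \<le> real N"
    using real_arch_simple by blast
  show "\<exists>N::nat. \<forall>g\<in>carrier G.
           word_length G S g \<ge> N \<longrightarrow> norm (b g) \<le> \<epsilon> * real (word_length G S g)"
  proof (intro exI[of _ N] ballI impI)
    fix g
    assume "g \<in> carrier G" and large: "N \<le> word_length G S g"
    obtain ws where ws: "set ws \<subseteq> S" "word_prod G ws = g" "length ws = word_length G S g"
      using geodesic_word[OF assms(3) \<open>g \<in> carrier G\<close>] .
    define n where "n = length ws"
    define v where "v i = \<pi> (word_prod G (take i ws)) (b (ws ! i))" for i
    have prefix: "set (take i ws) \<subseteq> carrier G" "word_prod G (take i ws) \<in> carrier G" for i
      using set_take_subset[of i ws] ws(1) S word_prod_closed[of "take i ws"] by blast+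
    have letter: "ws ! i \<in> S" if "i < n" for i
      using that ws(1) nth_mem n_def by blast
    have bg: "b g = (\<Sum>i<n. v i)"
      using cocycle_word_prod[OF assms(4,6), of ws] ws S by (simp add: n_def v_def)
    have "(norm (\<Sum>i<n. v i))\<^sup>2 \<le> \<epsilon>\<^sup>2 / 2 * (real n)\<^sup>2 + 2 * real m * M\<^sup>2 * real n"
    proof (rule norm_sum_almost_orthogonal)
      show "norm (v i) \<le> M" if "i < n" for i
        using M letter[OF that] prefix by (simp add: v_def unitary_rep_norm[OF assms(4)])
      show "\<bar>inner (v i) (v j)\<bar> \<le> \<epsilon>\<^sup>2 / 2" if ij: "i < j" "j < n" "m \<le> j - i" for i j
      proof -
        \<comment> \<open>The letters at positions \<open>i\<close> to \<open>j - 1\<close>: their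
          product is the quotient of the two prefixes, at which the matrix coefficient is
          evaluated.\<close>
        define us where "us = take (j - i) (drop i ws)"
        have us: "set us \<subseteq> S"
          unfolding us_def using ws(1) by (meson set_drop_subset set_take_subset subset_trans)
        then have h: "word_prod G us \<in> carrier G"
          using S word_prod_closed[of us] by blast
        have take_j: "take j ws = take i ws @ us"
          using ij by (simp add: us_def flip: take_add)
        then have split: "ws = take i ws @ us @ drop j ws"
          by (metis append_assoc append_take_drop_id)
        have "length us \<le> word_length G S (word_prod G us)"
        proof (rule word_length_factor[OF assms(3) _ us])
          show "set (take i ws) \<subseteq> S" "set (drop j ws) \<subseteq> S"
            using ws(1) set_take_subset set_drop_subset by fastforce+
          show "word_length G S (word_prod G (take i ws @ us @ drop j ws))
              = length (take i ws @ us @ drop j ws)"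
            using ws unfolding split[symmetric] by simp
        qed
        then have long: "m \<le> word_length G S (word_prod G us)"
          using ij by (simp add: us_def n_def)
        have "word_prod G (take j ws) = word_prod G (take i ws) \<otimes>\<^bsub>G\<^esub> word_prod G us"
          using prefix us S unfolding take_j by (intro word_prod_append) auto
        \<comment> \<open>The operator of the prefix of length \<open>i\<close> acts on both vectors
          and cancels, since it preserves inner products.\<close>
        then have "inner (v i) (v j) = inner (b (ws ! i)) (\<pi> (word_prod G us) (b (ws ! j)))"
          using prefix h
          by (simp add: v_def unitary_rep_mult[OF assms(4)] unitary_rep_inner[OF assms(4)])
        then show ?thesis
          using m[OF h long] letter ij by simp
      qed
    qed (use \<open>0 \<le> M\<close> \<open>0 < m\<close> in auto)
    also have "\<dots> \<le> (\<epsilon> * real n)\<^sup>2"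
    proof -
      have "4 * real m * M\<^sup>2 / \<epsilon>\<^sup>2 \<le> real n"
        using N large ws(3) n_def by linarith
      then have "4 * real m * M\<^sup>2 \<le> \<epsilon>\<^sup>2 * real n"
        using \<open>0 < \<epsilon>\<close> by (simp add: field_simps)
      then have "4 * real m * M\<^sup>2 * real n \<le> \<epsilon>\<^sup>2 * real n * real n"
        by (intro mult_right_mono) auto
      then show ?thesis
        by (simp add: power2_eq_square algebra_simps)
    qed
    finally have "norm (\<Sum>i<n. v i) \<le> \<epsilon> * real n"
      using \<open>0 < \<epsilon>\<close> by (auto intro: power2_le_imp_le)
    then show "norm (b g) \<le> \<epsilon> * real (word_length G S g)"
      using bg ws(3) n_def by simp
  qed
qed

end
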